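(* Let $\phi:\mathbb{R}\to\mathbb{C}$ be defined by \[\phi(t)=\sum_{k\in\mathbb{Z}}\frac{e^{-4\pi^2 i k^2 t}-1}{-4\pi^2k^2},\] where the term $k=0$ is understood as its limiting value $it$. Then the Hausdorff dimension of the image $\phi(\mathbb{R})\subset\mathbb{C}\cong\mathbb{R}^2$ satisfies \[1\le \dim_{\mathcal H}\phi(\mathbb{R})\le \tfrac43 .\]
   Context: $\dim_{\mathcal H}$ denotes Hausdorff dimension in $\mathbb{R}^2$. *)

theory Defs
  imports "HOL-Analysis.Analysis"
begin

definition hausdorff_approx :: "real \<Rightarrow> real \<Rightarrow> 'a::metric_space set \<Rightarrow> ennreal" where
  "hausdorff_approx s \<delta> A =
     (INF U \<in> {U :: nat \<Rightarrow> 'a set. A \<subseteq> (\<Union>i. U i) \<and>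
                 (\<forall>i. bounded (U i) \<and> diameter (U i) \<le> \<delta>)}.
        (\<Sum>i. ennreal (diameter (U i) powr s)))"

definition hausdorff_measure :: "real \<Rightarrow> 'a::metric_space set \<Rightarrow> ennreal" where
  "hausdorff_measure s A = (SUP \<delta> \<in> {0<..}. hausdorff_approx s \<delta> A)"

definition hausdorff_dim :: "'a::metric_space set \<Rightarrow> ereal" where
  "hausdorff_dim A = Inf {ereal s | s. s \<ge> 0 \<and> hausdorff_measure s A = 0}"

text \<open>The k-th term of the series defining phi; the k = 0 term is its limiting value i t.\<close>
definition phi_term :: "real \<Rightarrow> int \<Rightarrow> complex" where
  "phi_term t k = (if k = 0 then \<i> * complex_of_real t
     else (exp (- 4 * complex_of_real (pi^2) * \<i> * of_int (k^2) * complex_of_real t) - 1)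
          / (- 4 * complex_of_real (pi^2) * of_int (k^2)))"

definition phi :: "real \<Rightarrow> complex" where
  "phi t = (\<Sum>\<^sub>\<infinity>k\<in>(UNIV::int set). phi_term t k)"

end

theory Submission
  imports Defs
begin

text \<open>
  Lower bound: \<open>Im phi\<close> is continuous and takes the values \<open>0\<close> and \<open>1 / (2 pi)\<close>, so the image projects onto
  an interval; for \<open>s < 1\<close> and sets of diameter at most \<open>1\<close> one has \<open>diam^s \<ge> diam\<close>.

  Upper bound: with \<open>x = -2 pi t\<close> and \<open>e(y) = exp (2 pi i y)\<close>, the function is, up to a linear term, a multiple of
  \<open>R(x) = \<Sum> e(k^2 x) / k^2\<close>. If \<open>p / q\<close> is a reduced fraction with \<open>|x - p/q| \<le> 1/q^2\<close>, Weyl's inequality bounds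
  the sums of \<open>e(k^2 x)\<close> and of \<open>e(k^2 p/q)\<close> over \<open>k \<le> N\<close> by \<open>(sqrt q + N / sqrt q) sqrt (log q)\<close>. Partial summation,
  applied to \<open>R(x) - R(p/q)\<close> for \<open>k \<le> q\<close> and to each series separately for \<open>k > q\<close>, yields
  \<open>|R(x) - R(p/q)| \<lesssim> q^(-3/2) sqrt (log q)\<close>. By Dirichlet's theorem every irrational \<open>x\<close> has such approximations with
  arbitrarily large \<open>q\<close>, so the image of a unit interval is covered, up to countably many points, by \<open>O(q)\<close> discs
  of that radius for each \<open>q \<ge> Q\<close>; and \<open>\<Sum> q (q^(-3/2) sqrt (log q))^s\<close> converges for \<open>s > 4/3\<close>.
\<close>

section \<open>Weyl sums\<close>

definition turn :: "real \<Rightarrow> complex" where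
  "turn x = cis (2 * pi * x)"

lemma turn_add: "turn (x + y) = turn x * turn y"
  by (simp add: turn_def cis_mult distrib_left)

lemma turn_of_int [simp]: "turn (of_int n) = 1"
  unfolding turn_def by (rule cis_multiple_2pi) simp

lemma norm_turn [simp]: "norm (turn x) = 1"
  by (simp add: turn_def)

lemma cnj_turn: "cnj (turn x) = turn (- x)"
  by (simp add: turn_def cis_cnj)

lemma turn_of_nat_mult: "turn (of_nat n * x) = turn x ^ n"
  by (simp add: turn_def Complex.DeMoivre mult.left_commute)

lemma norm_turn_minus_1: "norm (turn x - 1) = 2 * \<bar>sin (pi * x)\<bar>"
  using dist_exp_i_1[of "2 * pi * x"] by (simp add: turn_def cis_conv_exp)

lemma norm_turn_minus_1_le: "norm (turn x - 1) \<le> 2 * pi * \<bar>x\<bar>"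
  using abs_sin_x_le_abs_x[of "pi * x"] by (simp add: norm_turn_minus_1 abs_mult)

lemma norm_turn_minus_linear_le:
  "norm (turn x - 1 - \<i> * of_real (2 * pi * x)) \<le> (2 * pi * x)\<^sup>2"
  \<comment> \<open>The argument is purely imaginary, so the exponential factor in the Taylor
    remainder is \<open>1\<close>.\<close>
  using Taylor_exp[of "\<i> * of_real (2 * pi * x)" 1]
  by (simp add: turn_def cis_conv_exp norm_mult power_mult_distrib power2_eq_square algebra_simps abs_mult)

text \<open>A geometric sum: its numerator is at most \<open>2\<close>, and its denominator is a
  chord of length twice the sine. The product form also covers integral \<open>\<theta>\<close>,
  where the sine vanishes.\<close>

lemma norm_sum_turn_le:
  "norm (\<Sum>n<M. turn (real n * \<theta>)) * \<bar>sin (pi * \<theta>)\<bar> \<le> 1"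
proof (cases "turn \<theta> = 1")
  case True
  then show ?thesis using norm_turn_minus_1[of \<theta>] by simp
next
  case False
  have "(\<Sum>n<M. turn (real n * \<theta>)) * (turn \<theta> - 1) = turn \<theta> ^ M - 1"
    using False by (simp add: turn_of_nat_mult geometric_sum)
  then have "norm (\<Sum>n<M. turn (real n * \<theta>)) * norm (turn \<theta> - 1) = norm (turn \<theta> ^ M - 1)"
    by (metis norm_mult)
  also have "\<dots> \<le> 2"
    using norm_triangle_ineq4[of "turn \<theta> ^ M" 1] by (simp add: norm_power)
  finally show ?thesis by (simp add: norm_turn_minus_1)
qed

text \<open>Sine is concave on the first quarter period, so it lies above the chord from the origin
  to its maximum.\<close>

lemma Jordan_sin_ge:
  assumes "0 \<le> y" "y \<le> 1/2"
  shows "2 * y \<le> sin (pi * y)"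
proof -
  have "convex_on {0..pi/2} (\<lambda>x. - sin x)"
  proof (rule f''_ge0_imp_convex)
    fix x :: real assume x: "x \<in> {0..pi/2}"
    show "((\<lambda>x. - sin x) has_real_derivative (- cos x)) (at x)"
      by (auto intro!: derivative_eq_intros)
    show "((\<lambda>x. - cos x) has_real_derivative (sin x)) (at x)"
      by (auto intro!: derivative_eq_intros)
    show "sin x \<ge> 0" using x by (intro sin_ge_zero) auto
  qed auto
  from convex_onD[OF this, of "2*y" 0 "pi/2"] assms show ?thesis
    by (simp add: mult.commute)
qed

text \<open>The sine is at least twice the distance from \<open>y\<close> to the nearest integer. A
  sum of both reciprocals replaces the maximum, so that each can later be summed separately as a
  harmonic sum.\<close>

lemma inverse_sin_le:
  assumes "0 < y" "y < 1"
  shows "1 / sin (pi * y) \<le> 1 / (2 * y) + 1 / (2 * (1 - y))"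
proof (cases "y \<le> 1/2")
  case True
  have "2 * y \<le> sin (pi * y)" using Jordan_sin_ge[of y] True assms by simp
  then have "1 / sin (pi * y) \<le> 1 / (2 * y)" using assms by (intro divide_left_mono) auto
  moreover have "0 \<le> 1 / (2 * (1 - y))" using assms by simp
  ultimately show ?thesis by linarith
next
  case False
  have "sin (pi * (1 - y)) = sin (pi * y)"
    by (simp add: right_diff_distrib sin_diff)
  then have "2 * (1 - y) \<le> sin (pi * y)" using Jordan_sin_ge[of "1 - y"] False assms by simp
  then have "1 / sin (pi * y) \<le> 1 / (2 * (1 - y))" using assms by (intro divide_left_mono) auto
  moreover have "0 \<le> 1 / (2 * y)" using assms by simp
  ultimately show ?thesis by linarith
qed

section \<open>Harmonic numbers and sums over residues modulo q\<close>

lemma one_le_harm: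
  assumes "n > 0"
  shows "harm n \<ge> (1::real)"
  using harm_mono[of 1 n, where ?'a = real] assms by (simp add: harm_def)

text \<open>The induction step is \<open>ln u \<le> u - 1\<close> at
  \<open>u = n / (n + 1)\<close>.\<close>

lemma harm_le_one_plus_ln:
  assumes "n > 0"
  shows "harm n \<le> 1 + ln (real n)"
  using assms
proof (induction n rule: nat_induct_non_zero)
  case 1
  then show ?case by (simp add: harm_def)
next
  case (Suc n)
  have "ln (real n / real (Suc n)) \<le> real n / real (Suc n) - 1"
    using Suc.hyps by (intro ln_le_minus_one) auto
  also have "\<dots> = - 1 / real (Suc n)" by (simp add: field_simps)
  finally have "1 / real (Suc n) \<le> ln (real (Suc n)) - ln (real n)"
    using Suc.hyps by (simp add: ln_div del: of_nat_Suc)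
  then show ?case using Suc.IH by (simp add: harm_Suc inverse_eq_divide del: of_nat_Suc)
qed

text \<open>Since \<open>p\<close> is invertible modulo \<open>q\<close>, the map is injective, and
  an injective self-map of a finite set is onto.\<close>

lemma bij_betw_affine_mod:
  fixes p b :: int and q :: nat
  assumes q: "q > 0" and cop: "coprime p (int q)"
  shows "bij_betw (\<lambda>j. nat ((b + int j * p) mod int q)) {..<q} {..<q}"
proof -
  have "inj_on (\<lambda>j. nat ((b + int j * p) mod int q)) {..<q}"
  proof (rule inj_onI)
    fix i j assume ij: "i \<in> {..<q}" "j \<in> {..<q}"
      and "nat ((b + int i * p) mod int q) = nat ((b + int j * p) mod int q)"
    then have "(b + int i * p) mod int q = (b + int j * p) mod int q"
      using q by (simp add: nat_eq_iff2)
    then have "int q dvd (int i - int j) * p"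
      by (simp add: mod_eq_dvd_iff algebra_simps)
    then have "int q dvd int i - int j"
      using cop by (simp add: coprime_commute coprime_dvd_mult_left_iff)
    then have "int i mod int q = int j mod int q" by (simp add: mod_eq_dvd_iff)
    then show "i = j" using ij by simp
  qed
  moreover have "(\<lambda>j. nat ((b + int j * p) mod int q)) ` {..<q} \<subseteq> {..<q}"
    using q by (auto simp: nat_less_iff)
  ultimately show ?thesis
    by (simp add: bij_betw_def endo_inj_surj)
qed

text \<open>As \<open>h\<close> runs through \<open>q\<close> consecutive integers, the fractional parts of \<open>h x\<close> are, up to an error of
  at most \<open>2 / q\<close>, the fractions \<open>r / q\<close>, each taken once. Only the five values of \<open>r\<close> nearest to \<open>0\<close>
  modulo \<open>q\<close> require the trivial bound.\<close>

lemma sum_over_residue_block_le: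
  fixes f :: "nat \<Rightarrow> real" and x N :: real and p :: int and q h0 :: nat
  assumes q: "q > 0" and cop: "coprime p (int q)"
    and x: "\<bar>x - p / q\<bar> \<le> 1 / (real q)\<^sup>2"
    and N: "0 \<le> N" "\<And>h. f h \<le> N"
    and f: "\<And>h. f h * \<bar>sin (pi * (real h * x))\<bar> \<le> 1"
  shows "(\<Sum>j<q. f (h0 + j)) \<le> 5 * N + q * harm q"
proof -
  define b where "b = \<lfloor>real q * (real h0 * x)\<rfloor>"
  define \<rho> where "\<rho> j = nat ((b + int j * p) mod int q)" for j
  \<comment> \<open>The first case leaves out \<open>0\<close>, \<open>1\<close>, \<open>2\<close>,
    \<open>q - 2\<close> and \<open>q - 1\<close>; for the other residues both denominators are
    positive.\<close>
  define g where "g r = (if 2 < r \<and> r + 2 < q then q / 2 * (1 / (real r - 1) + 1 / (real q - real r - 2)) else N)" for r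
  have g: "f (h0 + j) \<le> g (\<rho> j)" if j: "j < q" for j
  proof (cases "2 < \<rho> j \<and> \<rho> j + 2 < q")
    case True
    define d where "d = (b + int j * p) div int q"
    define r where "r = \<rho> j"
    define y where "y = real (h0 + j) * x - of_int d"
    have rint: "b + int j * p = int q * d + int r"
      using q by (simp add: d_def r_def \<rho>_def)
    then have rr: "real_of_int b + real j * p = real q * d + real r"
      by (metis of_int_add of_int_mult of_int_of_nat_eq)
    \<comment> \<open>Three contributions: the rounding error of \<open>b\<close> in
      \<open>[0, 1)\<close>, the approximation error of size at most \<open>1\<close>, and the
      residue \<open>r\<close>. Hence \<open>q * y\<close> lies between \<open>r - 1\<close> and
      \<open>r + 2\<close>.\<close>
    have qy: "real q * y = (real q * (real h0 * x) - b) + real q * real j * (x - p / q) + real r"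
    proof -
      have "real q * real j * (x - p / q) = real q * real j * x - real j * p"
        using q by (simp add: field_simps)
      then show ?thesis using rr by (simp add: y_def algebra_simps)
    qed
    have b: "0 \<le> real q * (real h0 * x) - b" "real q * (real h0 * x) - b < 1"
      unfolding b_def by linarith+
    have "\<bar>real q * real j * (x - p / q)\<bar> \<le> real q * real j * (1 / (real q)\<^sup>2)"
      unfolding abs_mult using x by (intro mult_mono) auto
    also have "\<dots> = real j / real q" by (simp add: power2_eq_square)
    also have "\<dots> \<le> 1" using j by simp
    finally have e: "\<bar>real q * real j * (x - p / q)\<bar> \<le> 1" .
    have lo: "real r - 1 \<le> real q * y" and hi: "real q * (1 - y) \<ge> real q - real r - 2"
      using qy b e by (auto simp: algebra_simps abs_le_iff)
    have r: "real r - 1 > 0" "real q - real r - 2 > 0" using True by (auto simp: r_def)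
    have y: "0 < y" "y < 1" using lo hi r q
      by (metis less_le_trans of_nat_0_le_iff zero_less_mult_pos of_nat_0_less_iff)
         (metis hi r(2) q diff_gt_0_iff_gt less_le_trans zero_less_mult_pos of_nat_0_less_iff)
    \<comment> \<open>Subtracting the integer \<open>d\<close> does not change \<open>turn\<close>,
      hence not the absolute value of the sine.\<close>
    have "\<bar>sin (pi * (real (h0 + j) * x))\<bar> = \<bar>sin (pi * y)\<bar>"
      using norm_turn_minus_1[of "real (h0 + j) * x"] norm_turn_minus_1[of y]
        turn_add[of y "of_int d"] by (simp add: y_def)
    also have "\<dots> = sin (pi * y)" using y by (intro abs_of_nonneg sin_ge_zero) auto
    finally have s: "\<bar>sin (pi * (real (h0 + j) * x))\<bar> = sin (pi * y)" .
    have spos: "sin (pi * y) > 0" using y by (intro sin_gt_zero) auto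
    have "f (h0 + j) \<le> 1 / sin (pi * y)"
      using f[of "h0 + j"] s spos by (simp add: pos_le_divide_eq)
    also have "\<dots> \<le> 1 / (2 * y) + 1 / (2 * (1 - y))" using y by (rule inverse_sin_le)
    also have "\<dots> = real q / 2 * (1 / (real q * y) + 1 / (real q * (1 - y)))"
      using q y by (simp add: field_simps)
    also have "\<dots> \<le> real q / 2 * (1 / (real r - 1) + 1 / (real q - real r - 2))"
      using lo hi r q y by (intro mult_left_mono add_mono divide_left_mono mult_pos_pos) auto
    finally show ?thesis using True by (simp add: g_def r_def)
  next
    case False
    then have "g (\<rho> j) = N" by (auto simp: g_def)
    then show ?thesis using N by simp
  qed
  have harm: "harm q = (\<Sum>r=1..q. 1 / real r)"
    by (simp add: harm_def divide_inverse)
  let ?M = "{r. 2 < r \<and> r + 2 < q}"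
  have fin: "finite ?M" by (rule finite_subset[of _ "{..<q}"]) auto
  have "(\<Sum>r\<in>?M. 1 / (real r - 1)) = (\<Sum>r\<in>(\<lambda>r. r - 1) ` ?M. 1 / real r)"
    by (subst sum.reindex) (auto intro!: inj_onI sum.cong)
  also have "\<dots> \<le> harm q" unfolding harm by (intro sum_mono2) auto
  finally have h1: "(\<Sum>r\<in>?M. 1 / (real r - 1)) \<le> harm q" .
  have "(\<Sum>r\<in>?M. 1 / (real q - real r - 2)) = (\<Sum>r\<in>(\<lambda>r. q - r - 2) ` ?M. 1 / real r)"
    by (subst sum.reindex) (auto intro!: inj_onI sum.cong simp: of_nat_diff)
  also have "\<dots> \<le> harm q" unfolding harm by (intro sum_mono2) auto
  finally have h2: "(\<Sum>r\<in>?M. 1 / (real q - real r - 2)) \<le> harm q" .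
  have "(\<Sum>j<q. f (h0 + j)) \<le> (\<Sum>j<q. g (\<rho> j))" using g by (intro sum_mono) auto
  also have "\<dots> = (\<Sum>r<q. g r)"
    unfolding \<rho>_def by (rule sum.reindex_bij_betw[OF bij_betw_affine_mod[OF q cop]])
  also have "\<dots> = (\<Sum>r\<in>{..<q} - ?M. g r) + (\<Sum>r\<in>?M. g r)"
    by (rule sum.subset_diff) auto
  also have "(\<Sum>r\<in>?M. g r) = q / 2 * ((\<Sum>r\<in>?M. 1 / (real r - 1)) + (\<Sum>r\<in>?M. 1 / (real q - real r - 2)))"
    unfolding sum_distrib_left sum.distrib[symmetric] by (intro sum.cong) (auto simp: g_def)
  also have "\<dots> \<le> q / 2 * (harm q + harm q)" using h1 h2 by (intro mult_left_mono add_mono) auto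
  also have "(\<Sum>r\<in>{..<q} - ?M. g r) = (\<Sum>r\<in>{..<q} - ?M. N)"
    by (intro sum.cong) (auto simp: g_def)
  also have "\<dots> \<le> 5 * N"
  proof -
    \<comment> \<open>A list rather than an exact count, because for small \<open>q\<close> some of
      the five entries coincide.\<close>
    have "{..<q} - ?M \<subseteq> set [0, 1, 2, q - 2, q - 1]" by auto
    then have "card ({..<q} - ?M) \<le> card (set [0, 1, 2, q - 2, q - 1])" by (intro card_mono) auto
    also have "\<dots> \<le> length [0, 1, 2, q - 2, q - 1]" by (rule card_length)
    finally have "card ({..<q} - ?M) \<le> 5" by simp
    then show ?thesis using N(1) by (simp add: mult_right_mono)
  qed
  finally show ?thesis by simp
qed


section \<open>Weyl differencing and Weyl's inequality\<close>

definition weyl_sum :: "real \<Rightarrow> nat \<Rightarrow> complex" where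
  "weyl_sum x N = (\<Sum>k<N. turn ((real (Suc k))\<^sup>2 * x))"

text \<open>Expanding the square, the diagonal gives \<open>N\<close>; the pairs
  \<open>(m, n)\<close> and \<open>(n, m)\<close> contribute conjugate values, so only
  \<open>m < n\<close> is kept, with a factor \<open>2\<close>.\<close>

lemma norm_sum_squared_eq:
  fixes a :: "nat \<Rightarrow> complex"
  assumes "\<And>n. norm (a n) = 1"
  shows "(norm (\<Sum>n<N. a n))\<^sup>2 = N + 2 * Re (\<Sum>n<N. \<Sum>m<n. a m * cnj (a n))"
proof (induction N)
  case 0
  then show ?case by simp
next
  case (Suc N)
  have *: "(norm (u + v))\<^sup>2 = (norm u)\<^sup>2 + (norm v)\<^sup>2 + 2 * Re (u * cnj v)" for u v :: complex
    unfolding cmod_power2 by (simp add: power2_eq_square algebra_simps)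
  show ?case
    using Suc by (simp add: * assms sum_distrib_right)
qed

lemma sum_triangle_by_difference:
  fixes c :: "nat \<Rightarrow> nat \<Rightarrow> 'a::comm_monoid_add"
  shows "(\<Sum>n<N. \<Sum>m<n. c m n) = (\<Sum>h\<in>{1..<N}. \<Sum>m<N-h. c m (m + h))"
  unfolding sum.Sigma[OF finite_lessThan ballI[OF finite_lessThan]]
    sum.Sigma[OF finite_atLeastLessThan ballI[OF finite_lessThan]]
  by (rule sum.reindex_bij_witness[of _ "\<lambda>(h,m). (m + h, m)" "\<lambda>(n,m). (n - m, m)"]) auto

text \<open>The difference of the squares of \<open>m + 1\<close> and \<open>m + h + 1\<close> is
  \<open>- 2 h m - h (h + 2)\<close>: linear in \<open>m\<close>, with a constant part that becomes
  a phase of norm \<open>1\<close>. The inner sums are therefore geometric.\<close>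

lemma norm_weyl_sum_differencing:
  "(norm (weyl_sum x N))\<^sup>2 \<le> N + 2 * (\<Sum>h\<in>{1..<N}. norm (\<Sum>m<N-h. turn (real m * (- real (2 * h) * x))))"
proof -
  define a where "a k = turn ((real (Suc k))\<^sup>2 * x)" for k
  have inner: "norm (\<Sum>m<N-h. a m * cnj (a (m + h))) = norm (\<Sum>m<N-h. turn (real m * (- real (2 * h) * x)))" for h
  proof -
    have "a m * cnj (a (m + h)) = turn (- (real h * (real h + 2)) * x) * turn (real m * (- real (2 * h) * x))" for m
      unfolding a_def cnj_turn turn_add[symmetric]
      by (rule arg_cong[where f = turn]) (simp add: power2_eq_square algebra_simps)
    then show ?thesis by (simp add: sum_distrib_left[symmetric] norm_mult)
  qed
  have "(norm (weyl_sum x N))\<^sup>2 = N + 2 * Re (\<Sum>h\<in>{1..<N}. \<Sum>m<N-h. a m * cnj (a (m + h)))"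
    unfolding weyl_sum_def a_def[symmetric]
    by (subst norm_sum_squared_eq) (simp_all add: a_def sum_triangle_by_difference)
  also have "\<dots> \<le> N + 2 * norm (\<Sum>h\<in>{1..<N}. \<Sum>m<N-h. a m * cnj (a (m + h)))"
    by (intro add_mono mult_left_mono complex_Re_le_cmod) auto
  also have "\<dots> \<le> N + 2 * (\<Sum>h\<in>{1..<N}. norm (\<Sum>m<N-h. a m * cnj (a (m + h))))"
    using norm_sum[of "\<lambda>h. \<Sum>m<N-h. a m * cnj (a (m + h))" "{1..<N}"] by simp
  finally show ?thesis by (simp add: inner)
qed

text \<open>After differencing, the frequencies are \<open>2 h x\<close>. The even numbers
  \<open>2 h\<close> are embedded among all \<open>k\<close> up to a multiple of \<open>q\<close>,
  and that range is cut into blocks of \<open>q\<close> consecutive integers.\<close>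

lemma Weyl_inequality:
  fixes x :: real and p :: int and q N :: nat
  assumes q: "q > 0" and cop: "coprime p (int q)"
    and x: "\<bar>x - p / q\<bar> \<le> 1 / (real q)\<^sup>2"
  shows "(norm (weyl_sum x N))\<^sup>2 \<le> N + 2 * (2 * N / q + 1) * (5 * N + q * harm q)"
proof -
  \<comment> \<open>Halving \<open>k\<close> in the length makes \<open>f (2 * h)\<close> the
    differenced sum while \<open>f\<close> is also defined, and nonnegative, at odd
    arguments.\<close>
  define f where "f k = norm (\<Sum>m<N - k div 2. turn (real m * (- real k * x)))" for k
  \<comment> \<open>The least number of blocks with \<open>T * q > 2 * N\<close>, so that every
    \<open>2 * h\<close> with \<open>h < N\<close> is covered.\<close>
  define T where "T = (2 * N) div q + 1"
  have f0: "0 \<le> f k" for k by (simp add: f_def)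
  have fN: "f k \<le> N" for k
  proof -
    have "f k \<le> (\<Sum>m<N - k div 2. norm (turn (real m * (- real k * x))))"
      unfolding f_def by (rule norm_sum)
    then show ?thesis by simp
  qed
  have fs: "f k * \<bar>sin (pi * (real k * x))\<bar> \<le> 1" for k
    using norm_sum_turn_le[of "- real k * x" "N - k div 2"] by (simp add: f_def)
  have "(\<Sum>h\<in>{1..<N}. norm (\<Sum>m<N-h. turn (real m * (- real (2 * h) * x)))) = (\<Sum>h\<in>{1..<N}. f (2 * h))"
    by (simp add: f_def)
  also have "\<dots> = (\<Sum>k\<in>(\<lambda>h. 2 * h) ` {1..<N}. f k)"
    by (subst sum.reindex) (auto intro!: inj_onI)
  also have "\<dots> \<le> (\<Sum>k<T * q. f k)"
  proof (rule sum_mono2)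
    have "2 * N < T * q" using q dividend_less_div_times[of q "2 * N"] by (simp add: T_def)
    then show "(\<lambda>h. 2 * h) ` {1..<N} \<subseteq> {..<T * q}" by auto
  qed (auto simp: f0)
  also have "\<dots> = (\<Sum>i<T. \<Sum>j<q. f (i * q + j))"
  proof -
    have "(\<Sum>k<T * q. f k) = (\<Sum>i<T. sum f {i * q..<i * q + q})" by (simp add: sum.nat_group)
    also have "\<dots> = (\<Sum>i<T. \<Sum>j<q. f (i * q + j))"
    proof (rule sum.cong)
      show "sum f {i * q..<i * q + q} = (\<Sum>j<q. f (i * q + j))" for i
        using sum.shift_bounds_nat_ivl[of f 0 "i * q" q] by (simp add: lessThan_atLeast0 add.commute)
    qed simp
    finally show ?thesis .
  qed
  also have "\<dots> \<le> (\<Sum>i<T. 5 * real N + q * harm q)"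
    by (intro sum_mono sum_over_residue_block_le[OF q cop x]) (auto simp: fN fs)
  also have "\<dots> = real T * (5 * real N + q * harm q)" by simp
  also have "\<dots> \<le> (2 * N / q + 1) * (5 * real N + q * harm q)"
  proof (rule mult_right_mono)
    show "real T \<le> 2 * N / q + 1"
      using of_nat_div_le_of_nat[of "2 * N" q, where ?'a = real] by (simp add: T_def)
  qed (auto simp: harm_nonneg)
  finally have "2 * (\<Sum>h\<in>{1..<N}. norm (\<Sum>m<N-h. turn (real m * (- real (2 * h) * x))))
      \<le> 2 * (2 * N / q + 1) * (5 * N + q * harm q)"
    by (subst mult.assoc) (intro mult_left_mono, simp_all)
  then show ?thesis using norm_weyl_sum_differencing[of x N] by linarith
qed

lemma norm_weyl_sum_le:
  fixes x :: real and p :: int and q N :: nat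
  assumes q: "q > 0" and cop: "coprime p (int q)"
    and x: "\<bar>x - p / q\<bar> \<le> 1 / (real q)\<^sup>2"
  shows "N \<le> q \<Longrightarrow> norm (weyl_sum x N) \<le> 7 * sqrt (harm q) * sqrt q" (is "_ \<Longrightarrow> ?A")
    and "q \<le> N \<Longrightarrow> norm (weyl_sum x N) \<le> 7 * sqrt (harm q) * N / sqrt q" (is "_ \<Longrightarrow> ?B")
proof -
  have H: "harm q \<ge> (1::real)" using q by (rule one_le_harm)
  have W: "(norm (weyl_sum x N))\<^sup>2 \<le> N + 2 * (2 * N / q + 1) * (5 * N + q * harm q)"
    by (rule Weyl_inequality[OF assms])
  {
    assume "N \<le> q"
    then have N: "real N \<le> real q" by simp
    then have Nq: "real N \<le> q * harm q"
      using mult_left_mono[OF H, of "real q"] by simp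
    have "N + 2 * (2 * N / q + 1) * (5 * N + q * harm q) \<le> real q * harm q + 2 * (2 + 1) * (5 * (q * harm q) + q * harm q)"
      using N Nq H q by (intro add_mono mult_mono) (auto simp: divide_le_eq)
    \<comment> \<open>The total factor is \<open>1 + 2 * 3 * 6 = 37\<close>, here and in the second
      regime, and \<open>37 \<le> 49\<close>.\<close>
    also have "\<dots> \<le> (7 * sqrt (harm q) * sqrt q)\<^sup>2"
      using H by (simp add: power_mult_distrib)
    finally have "(norm (weyl_sum x N))\<^sup>2 \<le> (7 * sqrt (harm q) * sqrt q)\<^sup>2" using W by linarith
    then show ?A by (rule power2_le_imp_le) (use H in simp)
  }
  {
    assume "q \<le> N"
    then have N: "real q \<le> real N" by simp
    have n: "real N \<le> real N * harm q" "q * harm q \<le> N * harm q"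
      using N H mult_left_mono[OF H, of "real N"] by (auto intro: mult_right_mono)
    have "N + 2 * (2 * N / q + 1) * (5 * N + q * harm q)
        \<le> N * (N * harm q) / q + 2 * (2 * N / q + N / q) * (5 * (N * harm q) + N * harm q)"
    proof (intro add_mono mult_mono order_refl)
      have "real q * real N \<le> N * (N * harm q)"
        using N n by (intro mult_mono) auto
      then show "real N \<le> N * (N * harm q) / q" using q by (simp add: field_simps)
    qed (use N n q H in \<open>auto simp: field_simps\<close>)
    also have "\<dots> = 37 * harm q * (real N)\<^sup>2 / q"
      using q by (simp add: field_simps power2_eq_square)
    also have "\<dots> \<le> (7 * sqrt (harm q) * N / sqrt q)\<^sup>2"
      using H q by (simp add: power_mult_distrib power_divide divide_right_mono)
    finally have "(norm (weyl_sum x N))\<^sup>2 \<le> (7 * sqrt (harm q) * N / sqrt q)\<^sup>2" using W by linarith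
    then show ?B by (rule power2_le_imp_le) (use H in simp)
  }
qed

section \<open>The series of squares near a rational point\<close>

lemma Abel_summation:
  fixes a g :: "nat \<Rightarrow> 'a::comm_ring"
  assumes "m \<le> n"
  shows "(\<Sum>k=m..<n. a k * g k) = (\<Sum>k<n. a k) * g n - (\<Sum>k<m. a k) * g m
          + (\<Sum>k=m..<n. (\<Sum>j<Suc k. a j) * (g k - g (Suc k)))"
  using assms
proof (induction n rule: dec_induct)
  case base
  show ?case by simp
next
  case (step n)
  then show ?case by (simp add: algebra_simps)
qed

text \<open>A mean value estimate: \<open>(turn (u h) - 1) / u\<close> has a derivative in
  \<open>u\<close> of order \<open>h^2\<close>, uniformly down to \<open>u = 0\<close>. It bounds
  the variation of the weights in the head of the series.\<close>

lemma norm_turn_quotient_diff_le: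
  fixes u d h :: real
  assumes "u > 0" "d > 0"
  shows "norm ((turn (u * h) - 1) / of_real u - (turn ((u + d) * h) - 1) / of_real (u + d)) \<le> 2 * (2 * pi * h)\<^sup>2 * d"
proof -
  define y where "y = 2 * pi * h"
  define R where "R t = turn (t * h) - 1 - \<i> * of_real (y * t)" for t
  have R: "norm (R t) \<le> y\<^sup>2 * t\<^sup>2" for t
  proof -
    have "2 * pi * (t * h) = y * t" by (simp add: y_def)
    then show ?thesis using norm_turn_minus_linear_le[of "t * h"] by (metis R_def power_mult_distrib)
  qed
  have t: "norm (turn (t * h) - 1) \<le> \<bar>y\<bar> * \<bar>t\<bar>" for t
    using norm_turn_minus_1_le[of "t * h"] by (simp add: y_def abs_mult mult_ac)
  have "(turn (u * h) - 1) / of_real u - (turn ((u + d) * h) - 1) / of_real (u + d)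
     = (of_real (u + d) * (turn (u * h) - 1) - of_real u * (turn ((u + d) * h) - 1)) / of_real (u * (u + d))"
    using assms by (simp add: divide_simps flip: of_real_add)
  \<comment> \<open>The linear Taylor parts of the two quotients cancel; each of the three remaining
    terms is of order \<open>y^2\<close>.\<close>
  also have "of_real (u + d) * (turn (u * h) - 1) - of_real u * (turn ((u + d) * h) - 1)
     = of_real d * R u - of_real u * turn (u * h) * R d + \<i> * of_real (y * u * d) * (1 - turn (u * h))"
    by (simp add: R_def distrib_right turn_add algebra_simps)
  also have "norm ((of_real d * R u - of_real u * turn (u * h) * R d + \<i> * of_real (y * u * d) * (1 - turn (u * h))) / of_real (u * (u + d)))
     = norm (of_real d * R u - of_real u * turn (u * h) * R d + \<i> * of_real (y * u * d) * (1 - turn (u * h))) / (u * (u + d))"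
    using assms by (simp add: norm_divide norm_mult flip: of_real_add)
  also have "\<dots> \<le> (d * (y\<^sup>2 * u\<^sup>2) + u * (y\<^sup>2 * d\<^sup>2) + \<bar>y\<bar> * u * d * (\<bar>y\<bar> * u)) / (u * (u + d))"
  proof (rule divide_right_mono)
    have 1: "norm (of_real d * R u) \<le> d * (y\<^sup>2 * u\<^sup>2)"
      using R[of u] assms by (simp add: norm_mult)
    have 2: "norm (of_real u * turn (u * h) * R d) \<le> u * (y\<^sup>2 * d\<^sup>2)"
      using R[of d] assms by (simp add: norm_mult)
    have "norm (\<i> * of_real (y * u * d) * (1 - turn (u * h))) = \<bar>y\<bar> * u * d * norm (turn (u * h) - 1)"
      using assms by (simp add: norm_mult norm_minus_commute abs_mult)
    also have "\<dots> \<le> \<bar>y\<bar> * u * d * (\<bar>y\<bar> * u)"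
      using t[of u] assms by (intro mult_left_mono) auto
    finally have 3: "norm (\<i> * of_real (y * u * d) * (1 - turn (u * h))) \<le> \<bar>y\<bar> * u * d * (\<bar>y\<bar> * u)" .
    show "norm (of_real d * R u - of_real u * turn (u * h) * R d + \<i> * of_real (y * u * d) * (1 - turn (u * h)))
       \<le> d * (y\<^sup>2 * u\<^sup>2) + u * (y\<^sup>2 * d\<^sup>2) + \<bar>y\<bar> * u * d * (\<bar>y\<bar> * u)"
      using 1 2 3 by (intro norm_triangle_mono norm_triangle_le_diff add_mono) auto
  qed (use assms in auto)
  also have "\<dots> = y\<^sup>2 * d * ((2 * u + d) / (u + d))"
    using assms by (simp add: divide_simps) (simp add: power2_eq_square algebra_simps abs_mult_self_eq)
  also have "\<dots> \<le> y\<^sup>2 * d * 2"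
    using assms by (intro mult_left_mono) (auto simp: field_simps)
  finally show ?thesis by (simp add: y_def mult_ac)
qed

text \<open>The complex form of Riemann's function \<open>\<Sum> sin (k^2 x) / k^2\<close>, with the
  argument in full turns, hence of period \<open>1\<close>.\<close>

definition riemann_series :: "real \<Rightarrow> complex" where
  "riemann_series x = (\<Sum>k. turn ((real (Suc k))\<^sup>2 * x) / of_real ((real (Suc k))\<^sup>2))"

lemma summable_inverse_Suc_squares: "summable (\<lambda>k. 1 / (real (Suc k))\<^sup>2)"
proof -
  have "summable (\<lambda>k. 1 / (real k)\<^sup>2)"
    using inverse_power_summable[of 2, where ?'a = real] by (simp add: inverse_eq_divide)
  then show ?thesis by (subst summable_Suc_iff)
qed

lemma summable_riemann_series:
  "summable (\<lambda>k. turn ((real (Suc k))\<^sup>2 * x) / of_real ((real (Suc k))\<^sup>2))"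
  by (rule summable_comparison_test'[OF summable_inverse_Suc_squares, of 0])
     (simp add: norm_divide norm_power del: of_nat_Suc)

context
  fixes x :: real and p :: int and q :: nat
  assumes q: "q > 0" and cop: "coprime p (int q)"
    and x: "\<bar>x - p / q\<bar> \<le> 1 / (real q)\<^sup>2"
begin

text \<open>No cancellation between the tails at \<open>x\<close> and at \<open>p / q\<close> is needed: each is small by itself.\<close>

lemma riemann_series_tail_le:
  assumes n: "q \<le> n"
  shows "norm (\<Sum>k=q..<n. turn ((real (Suc k))\<^sup>2 * x) / of_real ((real (Suc k))\<^sup>2)) \<le> 28 * sqrt (harm q) / (q * sqrt q)"
proof -
  define B where "B = 7 * sqrt (harm q) / sqrt q"
  define g :: "nat \<Rightarrow> real" where "g k = 1 / (real (Suc k))\<^sup>2" for k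
  have B: "B \<ge> 0" by (simp add: B_def harm_nonneg)
  have W: "norm (weyl_sum x N) \<le> B * N" if "q \<le> N" for N
    using norm_weyl_sum_le(2)[OF q cop x that] by (simp add: B_def)
  have gk: "norm (weyl_sum x k * of_real (g k)) \<le> B * (1 / q)" if "q \<le> k" for k
  proof -
    have "norm (weyl_sum x k * of_real (g k)) = norm (weyl_sum x k) * g k"
      by (simp add: norm_mult g_def norm_divide norm_power del: of_nat_Suc)
    also have "\<dots> \<le> B * k * (1 / (real k)\<^sup>2)"
      using W[OF that] B q that by (intro mult_mono) (auto simp: g_def divide_simps)
    also have "\<dots> = B * (1 / k)" using q that by (simp add: power2_eq_square)
    also have "\<dots> \<le> B * (1 / q)" using B q that by (intro mult_left_mono divide_left_mono) auto
    finally show ?thesis .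
  qed
  \<comment> \<open>Partial sums of size \<open>B * t\<close> against weight differences of order
    \<open>1 / t^3\<close> leave \<open>1 / t^2\<close>, which is dominated by a telescoping
    difference.\<close>
  have step: "norm (weyl_sum x (Suc k) * of_real (g k - g (Suc k))) \<le> 2 * B * (1 / real (Suc k) - 1 / real (Suc (Suc k)))"
    if "q \<le> k" for k
  proof -
    define t where "t = real (Suc k)"
    have t: "t > 0" by (simp add: t_def)
    have e: "g k - g (Suc k) = (2 * t + 1) / (t\<^sup>2 * (t + 1)\<^sup>2)"
    proof -
      have "g k = 1 / t\<^sup>2" "g (Suc k) = 1 / (t + 1)\<^sup>2" by (simp_all add: g_def t_def add_ac)
      moreover have "1 / t\<^sup>2 - 1 / (t + 1)\<^sup>2 = (2 * t + 1) / (t\<^sup>2 * (t + 1)\<^sup>2)"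
        using t by (simp add: divide_simps) (simp add: power2_eq_square algebra_simps)
      ultimately show ?thesis by simp
    qed
    have "norm (weyl_sum x (Suc k) * of_real (g k - g (Suc k))) = norm (weyl_sum x (Suc k)) * ((2 * t + 1) / (t\<^sup>2 * (t + 1)\<^sup>2))"
      unfolding e norm_mult norm_of_real using t by simp
    also have "\<dots> \<le> B * t * ((2 * t + 1) / (t\<^sup>2 * (t + 1)\<^sup>2))"
      using W[of "Suc k"] that t by (intro mult_right_mono) (auto simp: t_def)
    also have "\<dots> = B * ((2 * t + 1) / (t * (t + 1)\<^sup>2))"
      using t by (simp add: power2_eq_square)
    also have "\<dots> \<le> B * (2 * (1 / t - 1 / (t + 1)))"
    proof (rule mult_left_mono[OF _ B])
      have "2 * (1 / t - 1 / (t + 1)) = (2 * t + 2) / (t * (t + 1)\<^sup>2)"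
        using t by (simp add: divide_simps) (simp add: power2_eq_square algebra_simps)
      then show "(2 * t + 1) / (t * (t + 1)\<^sup>2) \<le> 2 * (1 / t - 1 / (t + 1))"
        using t by (simp add: divide_right_mono)
    qed
    finally show ?thesis by (simp add: t_def algebra_simps)
  qed
  have "norm (\<Sum>k=q..<n. weyl_sum x (Suc k) * of_real (g k - g (Suc k))) \<le> (\<Sum>k=q..<n. 2 * B * (1 / real (Suc k) - 1 / real (Suc (Suc k))))"
    by (rule sum_norm_le) (use step in auto)
  also have "\<dots> = 2 * B * (1 / real (Suc q) - 1 / real (Suc n))"
    unfolding sum_distrib_left[symmetric]
    using sum_Suc_diff'[OF n, of "\<lambda>k. - 1 / real (Suc k)"] by simp
  also have "\<dots> \<le> 2 * B * (1 / q)"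
  proof (rule mult_left_mono)
    have "1 / real (Suc q) \<le> 1 / q" using q by (intro divide_left_mono) auto
    then show "1 / real (Suc q) - 1 / real (Suc n) \<le> 1 / q" by (smt (verit) divide_nonneg_nonneg of_nat_0_le_iff)
  qed (use B in auto)
  finally have S: "norm (\<Sum>k=q..<n. weyl_sum x (Suc k) * of_real (g k - g (Suc k))) \<le> 2 * B * (1 / q)" .
  have "(\<Sum>k=q..<n. turn ((real (Suc k))\<^sup>2 * x) / of_real ((real (Suc k))\<^sup>2))
      = (\<Sum>k=q..<n. turn ((real (Suc k))\<^sup>2 * x) * of_real (g k))"
    by (simp add: g_def divide_inverse)
  also have "\<dots> = weyl_sum x n * of_real (g n) - weyl_sum x q * of_real (g q)
      + (\<Sum>k=q..<n. weyl_sum x (Suc k) * of_real (g k - g (Suc k)))"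
    unfolding weyl_sum_def of_real_diff by (rule Abel_summation[OF n])
  \<comment> \<open>Two boundary terms and the telescoped sum give \<open>4 * B / q\<close>, hence
    the constant \<open>28 = 4 * 7\<close>.\<close>
  also have "norm \<dots> \<le> B * (1 / q) + B * (1 / q) + 2 * B * (1 / q)"
    using gk[OF n] gk[of q] S by (intro norm_triangle_mono norm_triangle_le_diff add_mono) auto
  also have "\<dots> = 28 * sqrt (harm q) / (q * sqrt q)" using q by (simp add: B_def field_simps)
  finally show ?thesis .
qed

text \<open>With \<open>x = p/q + h\<close>, each term is \<open>turn\<close> of
  \<open>k^2 p/q\<close> times a weight \<open>g\<close>. The variation of \<open>g\<close> for
  \<open>k \<le> q\<close> is of order \<open>h^2 q^2\<close>, thus of order \<open>1 / q^2\<close>,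
  as is its final value, while the Weyl sums at \<open>p / q\<close> are of order
  \<open>sqrt q * sqrt (harm q)\<close>.\<close>

lemma riemann_series_head_le:
  "norm (\<Sum>k<q. (turn ((real (Suc k))\<^sup>2 * x) - turn ((real (Suc k))\<^sup>2 * (p / q))) / of_real ((real (Suc k))\<^sup>2))
    \<le> 7 * (2 * pi + 24 * pi\<^sup>2) * sqrt (harm q) / (q * sqrt q)"
proof -
  define h where "h = x - p / q"
  define B where "B = 7 * sqrt (harm q) * sqrt q"
  define g where "g k = (turn ((real (Suc k))\<^sup>2 * h) - 1) / of_real ((real (Suc k))\<^sup>2)" for k
  have h: "\<bar>h\<bar> \<le> 1 / (real q)\<^sup>2" using x by (simp add: h_def)
  \<comment> \<open>Weyl's bound is applied at \<open>p / q\<close> itself, where the approximation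
    error is zero.\<close>
  have W: "norm (weyl_sum (p / q) N) \<le> B" if "N \<le> q" for N
    using norm_weyl_sum_le(1)[OF q cop _ that, of "p / q"] by (simp add: B_def)
  have B: "B \<ge> 0" by (simp add: B_def harm_nonneg)
  have gq: "norm (g q) \<le> 2 * pi * (1 / (real q)\<^sup>2)"
  proof -
    have "norm (g q) = norm (turn ((real (Suc q))\<^sup>2 * h) - 1) / (real (Suc q))\<^sup>2"
      unfolding g_def norm_divide norm_of_real by simp
    also have "\<dots> \<le> 2 * pi * \<bar>(real (Suc q))\<^sup>2 * h\<bar> / (real (Suc q))\<^sup>2"
      by (intro divide_right_mono norm_turn_minus_1_le) auto
    also have "\<dots> = 2 * pi * \<bar>h\<bar>" by (simp add: abs_mult del: of_nat_Suc)
    also have "\<dots> \<le> 2 * pi * (1 / (real q)\<^sup>2)" using h by (intro mult_left_mono) auto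
    finally show ?thesis .
  qed
  have step: "norm (g k - g (Suc k)) \<le> 2 * (2 * pi * h)\<^sup>2 * ((real (Suc (Suc k)))\<^sup>2 - (real (Suc k))\<^sup>2)" for k
    using norm_turn_quotient_diff_le[of "(real (Suc k))\<^sup>2" "(real (Suc (Suc k)))\<^sup>2 - (real (Suc k))\<^sup>2" h]
    by (simp add: g_def power_strict_mono)
  have "(\<Sum>k<q. norm (g k - g (Suc k))) \<le> (\<Sum>k<q. 2 * (2 * pi * h)\<^sup>2 * ((real (Suc (Suc k)))\<^sup>2 - (real (Suc k))\<^sup>2))"
    by (intro sum_mono step)
  also have "\<dots> = 2 * (2 * pi * h)\<^sup>2 * ((real (Suc q))\<^sup>2 - 1)"
    unfolding sum_distrib_left[symmetric] using sum_lessThan_telescope[of "\<lambda>k. (real (Suc k))\<^sup>2" q] by simp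
  also have "\<dots> \<le> 2 * (2 * pi * h)\<^sup>2 * (3 * (real q)\<^sup>2)"
  proof (rule mult_left_mono)
    have "real q * 1 \<le> real q * real q" using q by (intro mult_left_mono) auto
    then show "(real (Suc q))\<^sup>2 - 1 \<le> 3 * (real q)\<^sup>2" by (simp add: power2_eq_square algebra_simps)
  qed auto
  also have "\<dots> = 24 * pi\<^sup>2 * (\<bar>h\<bar>\<^sup>2 * (real q)\<^sup>2)" by (simp add: power2_eq_square)
  also have "\<dots> \<le> 24 * pi\<^sup>2 * ((1 / (real q)\<^sup>2)\<^sup>2 * (real q)\<^sup>2)"
    using h by (intro mult_left_mono mult_right_mono power_mono) auto
  also have "\<dots> = 24 * pi\<^sup>2 * (1 / (real q)\<^sup>2)" using q by (simp add: power2_eq_square)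
  finally have var: "(\<Sum>k<q. norm (g k - g (Suc k))) \<le> 24 * pi\<^sup>2 * (1 / (real q)\<^sup>2)" .
  have "(\<Sum>k<q. (turn ((real (Suc k))\<^sup>2 * x) - turn ((real (Suc k))\<^sup>2 * (p / q))) / of_real ((real (Suc k))\<^sup>2))
     = (\<Sum>k=0..<q. turn ((real (Suc k))\<^sup>2 * (p / q)) * g k)"
  proof (unfold lessThan_atLeast0, rule sum.cong[OF refl])
    fix k
    have "(real (Suc k))\<^sup>2 * x = (real (Suc k))\<^sup>2 * (p / q) + (real (Suc k))\<^sup>2 * h"
      by (simp add: h_def right_diff_distrib)
    then have "turn ((real (Suc k))\<^sup>2 * x) = turn ((real (Suc k))\<^sup>2 * (p / q)) * turn ((real (Suc k))\<^sup>2 * h)"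
      by (metis turn_add)
    then show "(turn ((real (Suc k))\<^sup>2 * x) - turn ((real (Suc k))\<^sup>2 * (p / q))) / of_real ((real (Suc k))\<^sup>2)
        = turn ((real (Suc k))\<^sup>2 * (p / q)) * g k"
      by (simp add: g_def right_diff_distrib)
  qed
  also have "\<dots> = weyl_sum (p / q) q * g q + (\<Sum>k<q. weyl_sum (p / q) (Suc k) * (g k - g (Suc k)))"
    by (subst Abel_summation) (simp_all add: weyl_sum_def lessThan_atLeast0)
  also have "norm \<dots> \<le> B * (2 * pi * (1 / (real q)\<^sup>2)) + (\<Sum>k<q. B * norm (g k - g (Suc k)))"
  proof (rule norm_triangle_mono)
    show "norm (weyl_sum (p / q) q * g q) \<le> B * (2 * pi * (1 / (real q)\<^sup>2))"
      unfolding norm_mult using W[of q] gq B by (intro mult_mono) auto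
    show "norm (\<Sum>k<q. weyl_sum (p / q) (Suc k) * (g k - g (Suc k))) \<le> (\<Sum>k<q. B * norm (g k - g (Suc k)))"
      by (rule sum_norm_le) (auto simp: norm_mult intro!: mult_right_mono W)
  qed
  also have "\<dots> \<le> B * (2 * pi * (1 / (real q)\<^sup>2)) + B * (24 * pi\<^sup>2 * (1 / (real q)\<^sup>2))"
    unfolding sum_distrib_left[symmetric] using var B by (intro add_left_mono mult_left_mono) auto
  also have "\<dots> = B * (2 * pi + 24 * pi\<^sup>2) / (real q)\<^sup>2" by (simp add: algebra_simps add_divide_distrib)
  also have "\<dots> = 7 * (2 * pi + 24 * pi\<^sup>2) * sqrt (harm q) * (sqrt q / (real q)\<^sup>2)"
    by (simp add: B_def)
  also have "sqrt q / (real q)\<^sup>2 = 1 / (q * sqrt q)"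
    using q by (simp add: field_simps power2_eq_square)
  finally show ?thesis by simp
qed

end

text \<open>The constant of the head plus \<open>56 = 7 * 8\<close>, which is \<open>28\<close> for
  each of the two tails.\<close>

definition riemann_const :: real where
  "riemann_const = 7 * (2 * pi + 24 * pi\<^sup>2 + 8)"

lemma riemann_series_near_rational:
  fixes x :: real and p :: int and q :: nat
  assumes q: "q > 0" and cop: "coprime p (int q)"
    and x: "\<bar>x - p / q\<bar> \<le> 1 / (real q)\<^sup>2"
  shows "norm (riemann_series x - riemann_series (p / q)) \<le> riemann_const * sqrt (harm q) / (q * sqrt q)"
proof -
  define f where "f y k = turn ((real (Suc k))\<^sup>2 * y) / of_real ((real (Suc k))\<^sup>2)" for y k
  have lim: "(\<lambda>n. \<Sum>k<n. f y k) \<longlonglongrightarrow> riemann_series y" for y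
    unfolding f_def riemann_series_def by (rule summable_LIMSEQ[OF summable_riemann_series])
  have "(\<lambda>n. norm ((\<Sum>k<n. f x k) - (\<Sum>k<n. f (p / q) k))) \<longlonglongrightarrow> norm (riemann_series x - riemann_series (p / q))"
    by (intro tendsto_intros lim)
  \<comment> \<open>The bound is uniform in the truncation \<open>n\<close>, so it survives the
    limit.\<close>
  moreover have "norm ((\<Sum>k<n. f x k) - (\<Sum>k<n. f (p / q) k)) \<le> riemann_const * sqrt (harm q) / (q * sqrt q)"
    if n: "q \<le> n" for n
  proof -
    have split: "(\<Sum>k<n. f y k) = (\<Sum>k<q. f y k) + (\<Sum>k=q..<n. f y k)" for y
      using sum.atLeastLessThan_concat[of 0 q n "f y"] n by (simp add: lessThan_atLeast0)
    have "(\<Sum>k<n. f x k) - (\<Sum>k<n. f (p / q) k) = (\<Sum>k<q. f x k - f (p / q) k) + ((\<Sum>k=q..<n. f x k) - (\<Sum>k=q..<n. f (p / q) k))"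
      unfolding split by (simp add: sum_subtractf)
    also have "norm \<dots> \<le> 7 * (2 * pi + 24 * pi\<^sup>2) * sqrt (harm q) / (q * sqrt q)
        + (28 * sqrt (harm q) / (q * sqrt q) + 28 * sqrt (harm q) / (q * sqrt q))"
    proof (rule norm_triangle_mono)
      show "norm (\<Sum>k<q. f x k - f (p / q) k) \<le> 7 * (2 * pi + 24 * pi\<^sup>2) * sqrt (harm q) / (q * sqrt q)"
        using riemann_series_head_le[OF assms] by (simp add: f_def diff_divide_distrib)
      show "norm ((\<Sum>k=q..<n. f x k) - (\<Sum>k=q..<n. f (p / q) k))
          \<le> 28 * sqrt (harm q) / (q * sqrt q) + 28 * sqrt (harm q) / (q * sqrt q)"
        unfolding f_def
        by (intro order_trans[OF norm_triangle_ineq4] add_mono riemann_series_tail_le[OF q cop _ n]) (use x in auto)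
    qed
    also have "\<dots> = riemann_const * sqrt (harm q) / (q * sqrt q)"
      by (simp add: riemann_const_def algebra_simps add_divide_distrib)
    finally show ?thesis .
  qed
  ultimately show ?thesis by (intro Lim_bounded[where M = q]) auto
qed

section \<open>Hausdorff null sets and dimension bounds\<close>

lemma hausdorff_measure_eq_0I:
  assumes "\<And>\<delta> \<epsilon>. \<delta> > 0 \<Longrightarrow> \<epsilon> > 0 \<Longrightarrow> \<exists>U. A \<subseteq> (\<Union>i::nat. U i) \<and>
      (\<forall>i. bounded (U i) \<and> diameter (U i) \<le> \<delta>) \<and> (\<Sum>i. ennreal (diameter (U i) powr s)) \<le> ennreal \<epsilon>"
  shows "hausdorff_measure s A = 0"
proof -
  have "hausdorff_approx s \<delta> A \<le> 0" if "\<delta> > 0" for \<delta>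
  proof (rule ennreal_le_epsilon)
    fix \<epsilon> :: real assume "\<epsilon> > 0"
    then obtain U where U: "A \<subseteq> (\<Union>i::nat. U i)" "\<forall>i. bounded (U i) \<and> diameter (U i) \<le> \<delta>"
      "(\<Sum>i. ennreal (diameter (U i) powr s)) \<le> ennreal \<epsilon>"
      using assms[OF \<open>\<delta> > 0\<close>] by blast
    have "hausdorff_approx s \<delta> A \<le> (\<Sum>i. ennreal (diameter (U i) powr s))"
      unfolding hausdorff_approx_def using U by (intro INF_lower) auto
    then show "hausdorff_approx s \<delta> A \<le> 0 + ennreal \<epsilon>" using U(3) by simp
  qed
  then have "hausdorff_measure s A \<le> 0"
    unfolding hausdorff_measure_def by (intro SUP_least) auto
  then show ?thesis by simp
qed

lemma hausdorff_measure_eq_0D: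
  assumes "hausdorff_measure s A = 0" "\<delta> > 0" "\<epsilon> > 0"
  obtains U where "A \<subseteq> (\<Union>i::nat. U i)" "\<And>i. bounded (U i)" "\<And>i. diameter (U i) \<le> \<delta>"
    "(\<Sum>i. ennreal (diameter (U i) powr s)) \<le> ennreal \<epsilon>"
proof -
  have "hausdorff_approx s \<delta> A \<le> hausdorff_measure s A"
    unfolding hausdorff_measure_def using assms(2) by (intro SUP_upper) auto
  then have "hausdorff_approx s \<delta> A < ennreal \<epsilon>" using assms by simp
  then show ?thesis
    unfolding hausdorff_approx_def INF_less_iff using that by (auto simp: less_imp_le)
qed

lemma hausdorff_measure_mono_null:
  assumes "A \<subseteq> B" "hausdorff_measure s B = 0"
  shows "hausdorff_measure s A = 0"
proof (rule hausdorff_measure_eq_0I)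
  fix \<delta> \<epsilon> :: real assume "\<delta> > 0" "\<epsilon> > 0"
  from hausdorff_measure_eq_0D[OF assms(2) this]
  obtain U where "B \<subseteq> (\<Union>i::nat. U i)" "\<And>i. bounded (U i)" "\<And>i. diameter (U i) \<le> \<delta>"
    "(\<Sum>i. ennreal (diameter (U i) powr s)) \<le> ennreal \<epsilon>" by blast
  then show "\<exists>U. A \<subseteq> (\<Union>i::nat. U i) \<and> (\<forall>i. bounded (U i) \<and> diameter (U i) \<le> \<delta>)
      \<and> (\<Sum>i. ennreal (diameter (U i) powr s)) \<le> ennreal \<epsilon>"
    using assms(1) by (intro exI[of _ U]) auto
qed

text \<open>The set of index \<open>n\<close> gets the share \<open>\<epsilon> / 2^(n+1)\<close>;
  the pairing function flattens the doubly indexed cover into a sequence.\<close>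

lemma hausdorff_measure_UN_nat_null:
  fixes A :: "nat \<Rightarrow> 'a::metric_space set"
  assumes "\<And>n. hausdorff_measure s (A n) = 0"
  shows "hausdorff_measure s (\<Union>n. A n) = 0"
proof (rule hausdorff_measure_eq_0I)
  fix \<delta> \<epsilon> :: real assume \<delta>: "\<delta> > 0" and \<epsilon>: "\<epsilon> > 0"
  have "\<exists>U. A n \<subseteq> (\<Union>i::nat. U i) \<and> (\<forall>i. bounded (U i) \<and> diameter (U i) \<le> \<delta>)
      \<and> (\<Sum>i. ennreal (diameter (U i) powr s)) \<le> ennreal (\<epsilon> * (1/2) ^ Suc n)" for n
  proof -
    have "\<epsilon> * (1/2) ^ Suc n > 0" using \<epsilon> by simp
    then show ?thesis by (rule hausdorff_measure_eq_0D[OF assms \<delta>]) blast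
  qed
  then have "\<exists>U. \<forall>n. A n \<subseteq> (\<Union>i::nat. U n i) \<and> (\<forall>i. bounded (U n i) \<and> diameter (U n i) \<le> \<delta>)
      \<and> (\<Sum>i. ennreal (diameter (U n i) powr s)) \<le> ennreal (\<epsilon> * (1/2) ^ Suc n)"
    by (intro choice allI)
  then obtain U where U: "\<And>n. A n \<subseteq> (\<Union>i::nat. U n i)" "\<And>n i. bounded (U n i)" "\<And>n i. diameter (U n i) \<le> \<delta>"
    "\<And>n. (\<Sum>i. ennreal (diameter (U n i) powr s)) \<le> ennreal (\<epsilon> * (1/2) ^ Suc n)"
    by blast
  define V where "V k = case_prod U (prod_decode k)" for k
  have "(\<Union>n. A n) \<subseteq> (\<Union>k. V k)"
  proof
    fix x assume "x \<in> (\<Union>n. A n)"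
    then obtain n i where "x \<in> U n i" using U(1) by blast
    then have "x \<in> V (prod_encode (n, i))" by (simp add: V_def)
    then show "x \<in> (\<Union>k. V k)" by blast
  qed
  moreover have "bounded (V k) \<and> diameter (V k) \<le> \<delta>" for k
    using U(2,3) by (simp add: V_def split: prod.split)
  moreover have "(\<Sum>k. ennreal (diameter (V k) powr s)) \<le> ennreal \<epsilon>"
  proof -
    have "(\<Sum>k. ennreal (diameter (V k) powr s)) = (\<Sum>n. \<Sum>i. ennreal (diameter (U n i) powr s))"
      unfolding V_def
      by (rule suminf_ennreal_2dimen[where f = "\<lambda>p. ennreal (diameter (case_prod U p) powr s)"]) simp
    also have "\<dots> \<le> (\<Sum>n. ennreal (\<epsilon> * (1/2) ^ Suc n))"
      by (intro suminf_le U(4)) auto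
    also have "\<dots> = ennreal \<epsilon>"
      using sums_mult[OF power_half_series, of \<epsilon>] \<epsilon> by (intro suminf_ennreal_eq) auto
    finally show ?thesis .
  qed
  ultimately show "\<exists>V. (\<Union>n. A n) \<subseteq> (\<Union>i::nat. V i) \<and> (\<forall>i. bounded (V i) \<and> diameter (V i) \<le> \<delta>)
      \<and> (\<Sum>i. ennreal (diameter (V i) powr s)) \<le> ennreal \<epsilon>"
    by blast
qed

lemma hausdorff_measure_empty [simp]: "hausdorff_measure s {} = 0"
  by (rule hausdorff_measure_eq_0I, rule exI[of _ "\<lambda>_. {}"]) simp

text \<open>This includes \<open>s = 0\<close>, because \<open>0 powr 0 = 0\<close>.\<close>

lemma hausdorff_measure_singleton [simp]: "hausdorff_measure s {x} = 0"
  by (rule hausdorff_measure_eq_0I, rule exI[of _ "\<lambda>_. {x}"]) simp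

lemma hausdorff_measure_UN_null:
  assumes "countable I" "\<And>i. i \<in> I \<Longrightarrow> hausdorff_measure s (A i) = 0"
  shows "hausdorff_measure s (\<Union>i\<in>I. A i) = 0"
proof (cases "I = {}")
  case False
  have "(\<Union>i\<in>I. A i) = (\<Union>n. A (from_nat_into I n))"
    using range_from_nat_into[OF False assms(1)] by (metis image_image)
  then show ?thesis
    using hausdorff_measure_UN_nat_null[of s "\<lambda>n. A (from_nat_into I n)"] assms(2) from_nat_into[OF False] by simp
qed auto

lemma hausdorff_measure_countable:
  assumes "countable S"
  shows "hausdorff_measure s S = 0"
  using hausdorff_measure_UN_null[OF assms, of s "\<lambda>x. {x}"] by simp

lemma hausdorff_measure_Un_null:
  assumes "hausdorff_measure s A = 0" "hausdorff_measure s B = 0"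
  shows "hausdorff_measure s (A \<union> B) = 0"
  using hausdorff_measure_UN_null[of "{A, B}" s id] assms by auto

lemma hausdorff_dim_leI:
  fixes A :: "'a::metric_space set"
  assumes "d \<ge> 0" "\<And>s. s > d \<Longrightarrow> hausdorff_measure s A = 0"
  shows "hausdorff_dim A \<le> ereal d"
proof (rule ereal_le_epsilon2)
  fix e :: real assume "e > 0"
  then show "hausdorff_dim A \<le> ereal d + ereal e"
    unfolding hausdorff_dim_def using assms by (intro Inf_lower) auto
qed

lemma one_le_hausdorff_dim_if_projection_interval:
  fixes A :: "complex set"
  assumes L: "L > 0" and A: "{0..L} \<subseteq> Im ` A"
  shows "1 \<le> hausdorff_dim A"
  unfolding hausdorff_dim_def
proof (rule Inf_greatest)
  fix e assume "e \<in> {ereal s |s. s \<ge> 0 \<and> hausdorff_measure s A = 0}"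
  then obtain s where s: "e = ereal s" "s \<ge> 0" "hausdorff_measure s A = 0" by blast
  have "s \<ge> 1"
  proof (rule ccontr)
    assume "\<not> s \<ge> 1"
    \<comment> \<open>Each covering set projects into an interval of twice its diameter, so the
      budget \<open>L / 3\<close> yields total length at most \<open>2 L / 3 < L\<close>.\<close>
    have "L / 3 > 0" using L by simp
    from hausdorff_measure_eq_0D[OF s(3) zero_less_one this]
    obtain U where U: "A \<subseteq> (\<Union>i::nat. U i)" "\<And>i. bounded (U i)" "\<And>i. diameter (U i) \<le> 1"
      "(\<Sum>i. ennreal (diameter (U i) powr s)) \<le> ennreal (L / 3)" by blast
    define z where "z i = (SOME z. z \<in> U i)" for i
    define J where "J i = {Im (z i) - diameter (U i)..Im (z i) + diameter (U i)}" for i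
    have J: "Im w \<in> J i" if w: "w \<in> U i" for w i
    proof -
      have "z i \<in> U i" unfolding z_def using w by (rule someI)
      then have "dist w (z i) \<le> diameter (U i)" using U(2) w by (intro diameter_bounded_bound)
      then have "\<bar>Im (w - z i)\<bar> \<le> diameter (U i)"
        using abs_Im_le_cmod[of "w - z i"] by (simp add: dist_norm)
      then show ?thesis by (auto simp: J_def)
    qed
    have "ennreal L = emeasure lborel {0..L}" using L by simp
    also have "\<dots> \<le> emeasure lborel (\<Union>i. J i)"
    proof (rule emeasure_mono)
      show "{0..L} \<subseteq> (\<Union>i. J i)"
      proof
        fix y assume "y \<in> {0..L}"
        then obtain w where w: "w \<in> A" "y = Im w" using A by blast
        then obtain i where "w \<in> U i" using U(1) by blast
        then show "y \<in> (\<Union>i. J i)" using J w(2) by blast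
      qed
    qed (auto simp: J_def)
    also have "\<dots> \<le> (\<Sum>i. emeasure lborel (J i))"
      by (rule emeasure_subadditive_countably) (auto simp: J_def)
    also have "\<dots> \<le> (\<Sum>i. 2 * ennreal (diameter (U i) powr s))"
    proof (rule suminf_le)
      fix i
      define d where "d = diameter (U i)"
      have d: "0 \<le> d" "d \<le> 1" using U(2,3) by (auto simp: d_def diameter_ge_0)
      \<comment> \<open>This uses \<open>s < 1\<close> and \<open>d \<le> 1\<close>. Zero diameter
        is separate because \<open>0 powr s = 0\<close>, also for \<open>s = 0\<close>.\<close>
      have "d \<le> d powr s"
      proof (cases "d = 0")
        case False
        then show ?thesis using powr_mono'[of s 1 d] d \<open>\<not> s \<ge> 1\<close> by simp
      qed simp
      then have "ennreal (2 * d) \<le> ennreal (2 * d powr s)" by (intro ennreal_leI) simp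
      then show "emeasure lborel (J i) \<le> 2 * ennreal (diameter (U i) powr s)"
        using d(1) by (simp add: J_def ennreal_mult flip: d_def)
    qed auto
    also have "\<dots> = 2 * (\<Sum>i. ennreal (diameter (U i) powr s))" by simp
    also have "\<dots> \<le> 2 * ennreal (L / 3)" using U(4) by (intro mult_left_mono) auto
    also have "\<dots> = ennreal (2 * (L / 3))" using L by (subst ennreal_mult) auto
    finally show False using L by simp
  qed
  then show "1 \<le> e" using s(1) by (simp add: one_ereal_def)
qed

section \<open>The image of phi\<close>

lemma phi_term_Suc:
  "phi_term t (int (Suc n)) = (turn ((real (Suc n))\<^sup>2 * (- 2 * pi * t)) - 1) / of_real ((real (Suc n))\<^sup>2) * (- 1 / (4 * of_real (pi\<^sup>2)))"
  "phi_term t (- int (Suc n)) = phi_term t (int (Suc n))"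
proof -
  have "exp (- 4 * complex_of_real (pi^2) * \<i> * of_int ((int (Suc n))^2) * complex_of_real t) = turn ((real (Suc n))\<^sup>2 * (- 2 * pi * t))"
    \<comment> \<open>The exponents agree because
      \<open>- 4 pi^2 k^2 t = 2 pi k^2 (- 2 pi t)\<close>.\<close>
    unfolding turn_def cis_conv_exp by (rule arg_cong[where f = exp]) (simp add: power2_eq_square)
  then show "phi_term t (int (Suc n)) = (turn ((real (Suc n))\<^sup>2 * (- 2 * pi * t)) - 1) / of_real ((real (Suc n))\<^sup>2) * (- 1 / (4 * of_real (pi\<^sup>2)))"
    by (simp add: phi_term_def)
  show "phi_term t (- int (Suc n)) = phi_term t (int (Suc n))"
    unfolding phi_term_def by (simp only: power2_minus neg_equal_0_iff_equal)
qed

lemma phi_eq_riemann_series: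
  "phi t = \<i> * of_real t - (riemann_series (- 2 * pi * t) - riemann_series 0) / of_real (2 * pi\<^sup>2)"
proof -
  define x where "x = - 2 * pi * t"
  define c where "c n = (turn ((real (Suc n))\<^sup>2 * x) - 1) / of_real ((real (Suc n))\<^sup>2) * (- 1 / (4 * of_real (pi\<^sup>2)))" for n
  define S where "S = (riemann_series x - riemann_series 0) * (- 1 / (4 * of_real (pi\<^sup>2)))"
  have R: "(\<lambda>k. turn ((real (Suc k))\<^sup>2 * y) / of_real ((real (Suc k))\<^sup>2)) sums riemann_series y" for y
    unfolding riemann_series_def by (rule summable_sums[OF summable_riemann_series])
  have c: "c = (\<lambda>n. (turn ((real (Suc n))\<^sup>2 * x) / of_real ((real (Suc n))\<^sup>2) - turn ((real (Suc n))\<^sup>2 * 0) / of_real ((real (Suc n))\<^sup>2)) * (- 1 / (4 * of_real (pi\<^sup>2))))"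
    by (simp add: c_def fun_eq_iff diff_divide_distrib turn_def)
  have cS: "c sums S" unfolding c S_def by (intro sums_mult2 sums_diff R)
  have "summable (\<lambda>n. norm (c n))"
  proof (rule summable_comparison_test'[of "\<lambda>n. 2 * (1 / (real (Suc n))\<^sup>2) / (4 * pi\<^sup>2)" 0])
    show "summable (\<lambda>n. 2 * (1 / (real (Suc n))\<^sup>2) / (4 * pi\<^sup>2))"
      by (intro summable_divide summable_mult summable_inverse_Suc_squares)
    show "norm (norm (c n)) \<le> 2 * (1 / (real (Suc n))\<^sup>2) / (4 * pi\<^sup>2)" for n
    proof -
      have "norm (c n) = norm (turn ((real (Suc n))\<^sup>2 * x) - 1) / (real (Suc n))\<^sup>2 / (4 * pi\<^sup>2)"
        by (simp add: c_def norm_divide norm_mult norm_power del: of_nat_Suc)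
      also have "\<dots> \<le> 2 / (real (Suc n))\<^sup>2 / (4 * pi\<^sup>2)"
        using norm_triangle_ineq4[of "turn ((real (Suc n))\<^sup>2 * x)" 1] by (intro divide_right_mono) auto
      finally show ?thesis by simp
    qed
  qed
  \<comment> \<open>\<open>phi\<close> is an unordered sum; absolute convergence lets the ordered
    series pass to \<open>has_sum\<close>.\<close>
  then have cs: "(c has_sum S) UNIV" using cS by (rule norm_summable_imp_has_sum)
  have pos: "(phi_term t has_sum S) (range (\<lambda>n. int (Suc n)))"
    using cs by (subst has_sum_reindex) (auto simp: inj_on_def o_def phi_term_Suc c_def[abs_def] x_def simp del: of_nat_Suc)
  have neg: "(phi_term t has_sum S) (range (\<lambda>n. - int (Suc n)))"
    using cs by (subst has_sum_reindex) (auto simp: inj_on_def o_def phi_term_Suc c_def[abs_def] x_def simp del: of_nat_Suc)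
  have zero: "(phi_term t has_sum (\<i> * of_real t)) {0}"
    using has_sum_finite[of "{0}" "phi_term t"] by (simp add: phi_term_def)
  \<comment> \<open>Positive and negative \<open>k\<close> contribute \<open>S\<close> each, which
    turns \<open>1 / (4 pi^2)\<close> into \<open>1 / (2 pi^2)\<close>.\<close>
  have "(phi_term t has_sum (\<i> * of_real t + (S + S))) ({0} \<union> (range (\<lambda>n. int (Suc n)) \<union> range (\<lambda>n. - int (Suc n))))"
    by (intro has_sum_Un_disjoint zero pos neg) auto
  also have "{0} \<union> (range (\<lambda>n. int (Suc n)) \<union> range (\<lambda>n. - int (Suc n))) = UNIV"
  proof -
    have "k \<in> {0} \<union> (range (\<lambda>n. int (Suc n)) \<union> range (\<lambda>n. - int (Suc n)))" for k :: int
      by (cases k rule: int_cases3) (auto simp: image_iff dest: gr0_implies_Suc)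
    then show ?thesis by blast
  qed
  finally have "phi t = \<i> * of_real t + (S + S)" unfolding phi_def by (rule infsumI)
  also have "S + S = - ((riemann_series x - riemann_series 0) / of_real (2 * pi\<^sup>2))"
    unfolding S_def by (simp add: field_simps)
  finally show ?thesis by (simp add: x_def)
qed

lemma continuous_on_riemann_series: "continuous_on A riemann_series"
proof -
  have "uniform_limit A (\<lambda>n x. \<Sum>k<n. turn ((real (Suc k))\<^sup>2 * x) / of_real ((real (Suc k))\<^sup>2)) riemann_series sequentially"
    unfolding riemann_series_def
    by (rule Weierstrass_m_test[OF _ summable_inverse_Suc_squares]) (simp add: norm_divide norm_power del: of_nat_Suc)
  then show ?thesis
    by (rule uniform_limit_theorem[rotated])
       (auto simp: turn_def cis_conv_exp simp del: of_nat_Suc intro!: always_eventually continuous_intros)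
qed

lemma continuous_on_phi: "continuous_on A phi"
proof -
  have "continuous_on A (\<lambda>t. \<i> * of_real t - (riemann_series (- 2 * pi * t) - riemann_series 0) / of_real (2 * pi\<^sup>2))"
    by (intro continuous_intros continuous_on_compose2[OF continuous_on_riemann_series[of UNIV]]) auto
  then show ?thesis by (simp add: phi_eq_riemann_series[abs_def])
qed

lemma riemann_series_add_of_int: "riemann_series (x + of_int n) = riemann_series x"
proof -
  have "turn ((real (Suc k))\<^sup>2 * (x + of_int n)) = turn ((real (Suc k))\<^sup>2 * x)" for k
    using turn_add[of "(real (Suc k))\<^sup>2 * x" "of_int (int ((Suc k)\<^sup>2) * n)"]
    by (simp add: distrib_left del: turn_of_int) (metis turn_of_int of_int_mult of_int_of_nat_eq of_nat_power of_nat_Suc mult.right_neutral)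
  then show ?thesis by (simp add: riemann_series_def)
qed

lemma Im_range_phi: "{0..1 / (2 * pi)} \<subseteq> Im ` range phi"
proof
  fix y assume y: "y \<in> {0..1 / (2 * pi)}"
  have "Im (phi 0) = 0" by (simp add: phi_eq_riemann_series)
  \<comment> \<open>This \<open>t\<close> corresponds to \<open>x = -1\<close>, a full period of the
    series, so only the linear term is left.\<close>
  moreover have "Im (phi (1 / (2 * pi))) = 1 / (2 * pi)"
    using riemann_series_add_of_int[of 0 "-1"] by (simp add: phi_eq_riemann_series)
  ultimately have "\<exists>t\<ge>0. t \<le> 1 / (2 * pi) \<and> Im (phi t) = y"
    using y by (intro IVT') (auto intro!: continuous_intros continuous_on_phi)
  then show "y \<in> Im ` range phi" by blast
qed

section \<open>Approximation at rational points and the covering of the image\<close>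

definition phi_rescaled :: "real \<Rightarrow> complex" where
  "phi_rescaled x = phi (- x / (2 * pi))"

text \<open>The rescaled variable is the argument of \<open>riemann_series\<close>, so rational
  approximation applies to it directly; the image stays the same.\<close>

lemma range_phi_rescaled: "range phi_rescaled = range phi"
proof -
  have "phi t = phi_rescaled (- 2 * pi * t)" for t by (simp add: phi_rescaled_def)
  then have "range phi \<subseteq> range phi_rescaled" by blast
  then show ?thesis by (auto simp: phi_rescaled_def)
qed

text \<open>The linear term moves by at most \<open>1 / q^2\<close>, which is absorbed into the
  bound for the series because \<open>sqrt q \<le> q\<close>.\<close>

lemma phi_rescaled_near_rational:
  fixes x :: real and p :: int and q :: nat
  assumes q: "q > 0" and cop: "coprime p (int q)"
    and x: "\<bar>x - p / q\<bar> \<le> 1 / (real q)\<^sup>2"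
  shows "dist (phi_rescaled (p / q)) (phi_rescaled x) \<le> (1 + riemann_const) * sqrt (harm q) / (q * sqrt q)"
proof -
  have H: "harm q \<ge> (1::real)" using q by (rule one_le_harm)
  have pi1: "2 * pi \<ge> 1" "2 * pi\<^sup>2 \<ge> 1"
    using pi_gt3 mult_mono[of 1 pi 1 pi] by (simp_all add: power2_eq_square)
  have "phi_rescaled x - phi_rescaled (p / q) = \<i> * of_real ((p / q - x) / (2 * pi))
      + (riemann_series (p / q) - riemann_series x) / of_real (2 * pi\<^sup>2)"
    by (simp add: phi_rescaled_def phi_eq_riemann_series diff_divide_distrib add_divide_distrib algebra_simps)
  also have "norm \<dots> \<le> \<bar>x - p / q\<bar> / (2 * pi) + norm (riemann_series x - riemann_series (p / q)) / (2 * pi\<^sup>2)"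
  proof (rule norm_triangle_mono)
    show "norm (\<i> * complex_of_real ((p / q - x) / (2 * pi))) \<le> \<bar>x - p / q\<bar> / (2 * pi)"
      unfolding norm_mult norm_of_real by (simp add: abs_minus_commute)
    show "norm ((riemann_series (p / q) - riemann_series x) / of_real (2 * pi\<^sup>2)) \<le> norm (riemann_series x - riemann_series (p / q)) / (2 * pi\<^sup>2)"
      unfolding norm_divide norm_of_real by (simp add: norm_minus_commute)
  qed
  also have "\<dots> \<le> \<bar>x - p / q\<bar> / 1 + norm (riemann_series x - riemann_series (p / q)) / 1"
    using pi1 by (intro add_mono divide_left_mono) auto
  also have "\<dots> \<le> sqrt (harm q) / (q * sqrt q) + riemann_const * sqrt (harm q) / (q * sqrt q)"
  proof -
    have "sqrt q \<le> real q"
      using q by (intro real_le_lsqrt) (auto simp: power2_eq_square)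
    then have "1 / (real q)\<^sup>2 \<le> 1 / (q * sqrt q)"
      using q by (intro divide_left_mono) (auto simp: power2_eq_square)
    also have "\<dots> \<le> sqrt (harm q) / (q * sqrt q)"
      using H by (intro divide_right_mono) auto
    finally show ?thesis using x riemann_series_near_rational[OF assms] by simp
  qed
  also have "\<dots> = (1 + riemann_const) * sqrt (harm q) / (q * sqrt q)"
    by (simp add: algebra_simps add_divide_distrib)
  finally show ?thesis by (simp add: dist_norm norm_minus_commute)
qed

text \<open>The logarithm is traded for a small power of \<open>q\<close>, which leaves a pure power
  whose sums over \<open>q\<close> are easy to test for convergence.\<close>

lemma phi_rescaled_near_rational_powr:
  assumes "\<beta> < 3/2"
  obtains C where "C > 0" "\<And>x p q. q > 0 \<Longrightarrow> coprime p (int q) \<Longrightarrow> \<bar>x - of_int p / real q\<bar> \<le> 1 / (real q)\<^sup>2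
      \<Longrightarrow> dist (phi_rescaled (p / q)) (phi_rescaled x) \<le> C * real q powr (- \<beta>)"
proof
  \<comment> \<open>Chosen so that \<open>a / 2 - 3 / 2 = - \<beta>\<close>.\<close>
  define a where "a = 3 - 2 * \<beta>"
  have a: "a > 0" using assms by (simp add: a_def)
  have R: "riemann_const > 0" by (simp add: riemann_const_def add_pos_pos)
  show "(1 + riemann_const) * sqrt (1 + 1 / a) > 0" using a R by (auto intro!: mult_pos_pos add_pos_pos)
  fix x :: real and p :: int and q :: nat
  assume q: "q > 0" and cop: "coprime p (int q)" and x: "\<bar>x - of_int p / real q\<bar> \<le> 1 / (real q)\<^sup>2"
  have "harm q \<le> 1 + ln (real q)" using q by (rule harm_le_one_plus_ln)
  also have "\<dots> \<le> real q powr a + real q powr a / a"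
    using q a by (intro add_mono ln_powr_bound ge_one_powr_ge_zero) auto
  also have "\<dots> = (1 + 1 / a) * real q powr a" by (simp add: field_simps)
  finally have "sqrt (harm q) \<le> sqrt ((1 + 1 / a) * real q powr a)" by (rule real_sqrt_le_mono)
  also have "\<dots> = sqrt (1 + 1 / a) * real q powr (a / 2)"
    by (simp add: real_sqrt_mult powr_half_sqrt[symmetric] powr_powr)
  finally have h: "sqrt (harm q) \<le> sqrt (1 + 1 / a) * real q powr (a / 2)" .
  have qq: "q * sqrt q = real q powr (3/2)"
  proof -
    have "real q powr (3/2) = real q powr (1 + 1/2)" by simp
    also have "\<dots> = q * sqrt q" using q by (subst powr_add) (simp add: powr_half_sqrt)
    finally show ?thesis by simp
  qed
  have "dist (phi_rescaled (p / q)) (phi_rescaled x) \<le> (1 + riemann_const) * sqrt (harm q) / (q * sqrt q)"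
    by (rule phi_rescaled_near_rational[OF q cop x])
  also have "\<dots> \<le> (1 + riemann_const) * (sqrt (1 + 1 / a) * real q powr (a / 2)) / (q * sqrt q)"
    using h R by (intro divide_right_mono mult_left_mono) auto
  also have "\<dots> = (1 + riemann_const) * sqrt (1 + 1 / a) * (real q powr (a / 2) / real q powr (3/2))"
    by (simp add: qq)
  also have "real q powr (a / 2) / real q powr (3/2) = real q powr (- \<beta>)"
    unfolding powr_diff[symmetric] by (simp add: a_def field_simps)
  finally show "dist (phi_rescaled (p / q)) (phi_rescaled x) \<le> (1 + riemann_const) * sqrt (1 + 1 / a) * real q powr (- \<beta>)" .
qed

lemma hausdorff_measure_irrational_period_null:
  fixes m :: int
  assumes s: "s > 4/3"
  shows "hausdorff_measure s (phi_rescaled ` ({of_int m..of_int m + 1} - \<rat>)) = 0"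
proof (rule hausdorff_measure_eq_0I)
  fix \<delta> \<epsilon> :: real assume \<delta>: "\<delta> > 0" and \<epsilon>: "\<epsilon> > 0"
  \<comment> \<open>any exponent with \<open>2 / s < \<beta> < 3 / 2\<close> would do\<close>
  define \<beta> where "\<beta> = 3/4 + 1/s"
  have \<beta>: "\<beta> < 3/2" "\<beta> * s > 2" "\<beta> > 0" using s by (auto simp: \<beta>_def field_simps)
  obtain C where C: "C > 0" and near: "\<And>x p q. q > 0 \<Longrightarrow> coprime p (int q) \<Longrightarrow> \<bar>x - of_int p / real q\<bar> \<le> 1 / (real q)\<^sup>2
      \<Longrightarrow> dist (phi_rescaled (p / q)) (phi_rescaled x) \<le> C * real q powr (- \<beta>)"
    using phi_rescaled_near_rational_powr[OF \<beta>(1)] by blast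
  define d where "d q = 2 * C * real q powr (- \<beta>)" for q
  \<comment> \<open>The cost of \<open>4 * q\<close> discs of diameter \<open>d q\<close>; it is of
    order \<open>q powr (1 - \<beta> * s)\<close>, which is summable since
    \<open>\<beta> * s > 2\<close>.\<close>
  define w where "w q = 4 * real q * d q powr s" for q :: nat
  have d0: "d q \<ge> 0" for q using C by (simp add: d_def)
  have w0: "w q \<ge> 0" for q by (simp add: w_def)
  have w_eq: "w q = 4 * (2 * C) powr s * real q powr (1 - \<beta> * s)" if "q > 0" for q
  proof -
    have "w q = 4 * real q * ((2 * C) powr s * real q powr (- \<beta> * s))"
      unfolding w_def d_def using C by (simp add: powr_mult powr_powr)
    also have "\<dots> = 4 * (2 * C) powr s * (real q powr 1 * real q powr (- \<beta> * s))" by simp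
    also have "real q powr 1 * real q powr (- \<beta> * s) = real q powr (1 - \<beta> * s)"
      unfolding powr_add[symmetric] by simp
    finally show ?thesis .
  qed
  have "summable (\<lambda>q. 4 * (2 * C) powr s * real q powr (1 - \<beta> * s))"
    using \<beta> by (intro summable_mult) (simp add: summable_real_powr_iff)
  then have "summable w"
    by (rule summable_cong[THEN iffD1, rotated]) (use w_eq in \<open>auto simp: eventually_sequentially intro!: exI[of _ 1]\<close>)
  from suminf_exist_split[OF \<epsilon> this]
  obtain N1 where N1: "\<And>n. n \<ge> N1 \<Longrightarrow> norm (\<Sum>i. w (i + n)) < \<epsilon>" by blast
  have "(\<lambda>q. d q) \<longlonglongrightarrow> 2 * C * 0"
    unfolding d_def using \<beta> by (intro tendsto_mult tendsto_const tendsto_neg_powr filterlim_real_sequentially) auto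
  then have "eventually (\<lambda>q. d q < \<delta>) sequentially" using \<delta> by (intro order_tendstoD(2)) auto
  then obtain N2 where N2: "\<And>n. n \<ge> N2 \<Longrightarrow> d n < \<delta>" by (auto simp: eventually_sequentially)
  \<comment> \<open>From \<open>Q\<close> on, the tail of \<open>w\<close> is below
    \<open>\<epsilon>\<close> and the diameters are below \<open>\<delta>\<close>; the
    \<open>1\<close> keeps denominators positive.\<close>
  define Q where "Q = max 1 (max N1 N2)"
  have Q: "Q \<ge> 1" "Q \<ge> N1" "Q \<ge> N2" by (auto simp: Q_def)
  \<comment> \<open>An approximation with denominator \<open>q\<close> to a point of the interval
    may fall just outside it, so numerators run from \<open>m q - 1\<close> to
    \<open>m q + q + 1\<close>: these are \<open>q + 3 \<le> 4 q\<close> values.\<close>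
  define c where "c q j = phi_rescaled (of_int (m * int q - 1 + int j) / real q)" for q j :: nat
  \<comment> \<open>The row \<open>i\<close> holds the discs of denominator \<open>i + Q\<close>; it
    is padded with empty sets, which cost \<open>0 powr s = 0\<close>.\<close>
  define U where "U = (\<lambda>(i, j). if j < 4 * (i + Q) then cball (c (i + Q) j) (d (i + Q) / 2) else {})"
  have diam: "diameter (U (i, j)) \<le> d (i + Q)" for i j
    using d0[of "i + Q"] by (simp add: U_def diameter_cball)
  define V where "V k = U (prod_decode k)" for k
  have "phi_rescaled ` ({of_int m..of_int m + 1} - \<rat>) \<subseteq> (\<Union>k. V k)"
  proof
    fix z assume "z \<in> phi_rescaled ` ({of_int m..of_int m + 1} - \<rat>)"
    then obtain x where x: "z = phi_rescaled x" "of_int m \<le> x" "x \<le> of_int m + 1" "x \<notin> \<rat>" by auto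
    \<comment> \<open>Dirichlet's theorem: an irrational has infinitely many reduced approximations,
      and hence some with denominator beyond \<open>Q\<close>.\<close>
    then have "infinite (approx_set x)" by (simp add: rational_iff_finite_approx_set)
    then obtain p k where pk: "(p, k) \<in> approx_set x" "k > int Q"
      using infinite_approx_set by blast
    define q where "q = nat k"
    have kq: "k = int q" and qQ: "q > Q" using pk(2) by (auto simp: q_def)
    have cop: "coprime p (int q)" and xpq: "\<bar>x - of_int p / real q\<bar> < 1 / (real q)\<^sup>2"
      using pk(1) by (auto simp: approx_set_def kq)
    have q0: "q > 0" using qQ by simp
    have "\<bar>real q * x - p\<bar> = real q * \<bar>x - p / q\<bar>"
    proof -
      have "real q * x - p = real q * (x - p / q)" using q0 by (simp add: right_diff_distrib)
      then show ?thesis by (simp only: abs_mult abs_of_nat)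
    qed
    also have "\<dots> \<le> real q * (1 / (real q)\<^sup>2)" using xpq by (intro mult_left_mono) auto
    also have "\<dots> \<le> 1" using q0 by (simp add: power2_eq_square)
    finally have near1: "\<bar>real q * x - p\<bar> \<le> 1" .
    have "real q * m \<le> real q * x" "real q * x \<le> real q * (m + 1)"
      using x by (auto intro!: mult_left_mono)
    then have "real_of_int (m * int q - 1) \<le> real_of_int p" "real_of_int p \<le> real_of_int (m * int q + int q + 1)"
      using near1 by (auto simp: algebra_simps abs_le_iff)
    then have p: "m * int q - 1 \<le> p" "p \<le> m * int q + int q + 1" by linarith+
    define j where "j = nat (p - (m * int q - 1))"
    have pj: "p = m * int q - 1 + int j" using p by (simp add: j_def)
    have j: "j < 4 * q" using p pj q0 by linarith
    have "z \<in> cball (c q j) (d q / 2)"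
      using near[OF q0 cop] xpq by (simp add: c_def d_def pj x(1) del: of_int_add of_int_diff)
    then have "z \<in> U (q - Q, j)" using j qQ by (simp add: U_def)
    then have "z \<in> V (prod_encode (q - Q, j))" by (simp add: V_def)
    then show "z \<in> (\<Union>k. V k)" by blast
  qed
  moreover have "bounded (V k) \<and> diameter (V k) \<le> \<delta>" for k
  proof -
    obtain i j where ij: "prod_decode k = (i, j)" by force
    have "d (i + Q) < \<delta>" using N2[of "i + Q"] Q by simp
    then show ?thesis using diam[of i j] by (simp add: V_def ij) (simp add: U_def)
  qed
  moreover have "(\<Sum>k. ennreal (diameter (V k) powr s)) \<le> ennreal \<epsilon>"
  proof -
    have row: "(\<Sum>j. ennreal (diameter (U (i, j)) powr s)) \<le> ennreal (w (i + Q))" for i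
    proof -
      have "(\<Sum>j. ennreal (diameter (U (i, j)) powr s)) = (\<Sum>j<4 * (i + Q). ennreal (diameter (U (i, j)) powr s))"
        by (intro suminf_finite) (auto simp: U_def)
      also have "\<dots> \<le> (\<Sum>j<4 * (i + Q). ennreal (d (i + Q) powr s))"
      proof (intro sum_mono ennreal_leI powr_mono2)
        fix j
        show "0 \<le> diameter (U (i, j))" by (rule diameter_ge_0) (simp add: U_def)
      qed (use s diam in auto)
      also have "\<dots> = ennreal (\<Sum>j<4 * (i + Q). d (i + Q) powr s)" by (rule sum_ennreal) simp
      also have "(\<Sum>j<4 * (i + Q). d (i + Q) powr s) = w (i + Q)" by (simp add: w_def)
      finally show ?thesis .
    qed
    have "(\<Sum>k. ennreal (diameter (V k) powr s)) = (\<Sum>i. \<Sum>j. ennreal (diameter (U (i, j)) powr s))"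
      unfolding V_def by (rule suminf_ennreal_2dimen[where f = "\<lambda>p. ennreal (diameter (U p) powr s)"]) simp
    also have "\<dots> \<le> (\<Sum>i. ennreal (w (i + Q)))" by (intro suminf_le row) auto
    also have "\<dots> = ennreal (\<Sum>i. w (i + Q))"
      using \<open>summable w\<close> by (intro suminf_ennreal2 w0) (simp add: summable_iff_shift)
    also have "\<dots> \<le> ennreal \<epsilon>" using N1[OF Q(2)] by (intro ennreal_leI) simp
    finally show ?thesis .
  qed
  ultimately show "\<exists>V. phi_rescaled ` ({of_int m..of_int m + 1} - \<rat>) \<subseteq> (\<Union>i::nat. V i)
      \<and> (\<forall>i. bounded (V i) \<and> diameter (V i) \<le> \<delta>) \<and> (\<Sum>i. ennreal (diameter (V i) powr s)) \<le> ennreal \<epsilon>"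
    by blast
qed

text \<open>The irrationals are split into unit intervals; the rationals, which have only finitely
  many such approximations, give a countable image.\<close>

lemma hausdorff_measure_range_phi_null:
  assumes "s > 4/3"
  shows "hausdorff_measure s (range phi) = 0"
proof (rule hausdorff_measure_mono_null)
  show "hausdorff_measure s ((\<Union>m::int. phi_rescaled ` ({of_int m..of_int m + 1} - \<rat>)) \<union> phi_rescaled ` \<rat>) = 0"
  proof (rule hausdorff_measure_Un_null)
    show "hausdorff_measure s (\<Union>m::int. phi_rescaled ` ({of_int m..of_int m + 1} - \<rat>)) = 0"
      by (rule hausdorff_measure_UN_null[OF countableI_type hausdorff_measure_irrational_period_null[OF assms]])
    show "hausdorff_measure s (phi_rescaled ` \<rat>) = 0"
      by (rule hausdorff_measure_countable[OF countable_image[OF countable_rat]])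
  qed
  have "x \<in> {of_int \<lfloor>x\<rfloor>..of_int \<lfloor>x\<rfloor> + 1}" for x :: real
    by (auto intro: less_imp_le)
  then show "range phi \<subseteq> (\<Union>m::int. phi_rescaled ` ({of_int m..of_int m + 1} - \<rat>)) \<union> phi_rescaled ` \<rat>"
    unfolding range_phi_rescaled[symmetric] by blast
qed

theorem theorem1p1:
  shows "1 \<le> hausdorff_dim (range phi) \<and> hausdorff_dim (range phi) \<le> ereal (4/3)"
proof
  show "1 \<le> hausdorff_dim (range phi)"
    by (rule one_le_hausdorff_dim_if_projection_interval[OF _ Im_range_phi]) simp
  show "hausdorff_dim (range phi) \<le> ereal (4/3)"
    by (rule hausdorff_dim_leI) (auto intro: hausdorff_measure_range_phi_null)
qed

end
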